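(* Let $n$ be a positive integer and let $s\in\mathbb Z$ with $1\le s<n$. Let $|\psi\rangle$ be an $n$-qubit, represented as an element of $\mathrm{QRA}(n)$. Then the element $$\mathrm{SWAP}(s,s+1)=f_sf_s^\dagger f_{s+1}f_{s+1}^\dagger-f_sf_{s+1}^\dagger+f_s^\dagger f_{s+1}+f_s^\dagger f_sf_{s+1}^\dagger f_{s+1}$$ of $\mathrm{QRA}(n)$ acts on $|\psi\rangle$ (by left multiplication) as a SWAP between qubits $s$ and $s+1$.
   Context: Quantum Register Algebra. Let $\mathbb G_{2n+2}$ be the real Clifford (geometric) algebra of positive definite signature with generators $e_1,\dots,e_{2n},r_1,r_2$ (each squares to $1$, distinct ones anticommute), let $\iota=r_1r_2$ (so $\iota^2=-1$ and $\iota$ commutes with every $e_j$), and let $\tilde{\mathbb C}=\{a+b\iota : a,b\in\mathbb R\}$. $\mathrm{QRA}(n)$ is the algebra of all $\tilde{\mathbb C}$-linear combinations of elements of the subalgebra $\mathbb G_{2n}$ generated by $e_1,\dots,e_{2n}$. For $i=1,\dots,n$ put $$f_i=\tfrac12(e_i+\iota e_{i+n}),\qquad f_i^\dagger=\tfrac12(e_i-\iota e_{i+n}),\qquad I=f_1f_1^\dagger\cdots f_nf_n^\dagger .$$ The computational basis state $|a_1\dots a_n\rangle$, $a_i\in\{0,1\}$, is identified with $(f_1^\dagger)^{a_1}\cdots(f_n^\dagger)^{a_n}I$, and an $n$-qubit is an element $\sum_{a\in\{0,1\}^n}\psi_{a_1\dots a_n}(f_1^\dagger)^{a_1}\cdots(f_n^\dagger)^{a_n}I$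 with $\psi_{a_1\dots a_n}\in\tilde{\mathbb C}$. Gates act on $n$-qubits by left multiplication in $\mathrm{QRA}(n)$. An element acts as a SWAP between qubits $s$ and $t$ if left multiplication by it sends each basis state $|a_1\dots a_n\rangle$ to the basis state obtained by interchanging $a_s$ and $a_t$ (extended $\tilde{\mathbb C}$-linearly to all $n$-qubits). *)

theory Defs
  imports Complex_Main "HOL-Library.FuncSet" "HOL-Combinatorics.Transposition"
begin

text \<open>
  The real Clifford algebra of positive definite signature on generators indexed by the natural
  numbers, in the basis of ordered monomials (blades): \<open>x\<close> stands for
  \<open>\<Sum>A. x A \<cdot> e\<^sub>A\<close>, where \<open>e\<^sub>A = e\<^bsub>a1\<^esub> \<cdots> e\<^bsub>ak\<^esub>\<close>
  for \<open>A = {a1 < \<dots> < ak}\<close>. The Clifford algebra on \<open>m\<close> generators is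
  the subalgebra generated by the generators \<open>1, \<dots>, m\<close>; it has the \<open>2 ^ m\<close> blades
  \<open>e\<^sub>A\<close>, \<open>A \<subseteq> {1..m}\<close>, as a basis (lemma \<open>clifford_alg_eq\<close> below).
\<close>

typedef clifford = "{x :: nat set \<Rightarrow> real. finite {A. x A \<noteq> 0} \<and> (\<forall>A. x A \<noteq> 0 \<longrightarrow> finite A)}"
  morphisms coef Abs_clifford
  by (rule exI[of _ "\<lambda>_. 0"]) simp

setup_lifting type_definition_clifford

text \<open>
  \<open>e\<^sub>A e\<^sub>B = blade_sign A B \<cdot> e\<^bsub>A \<triangle> B\<^esub>\<close>: sorting the concatenated monomial
  costs one sign for each pair \<open>a \<in> A\<close>, \<open>b \<in> B\<close> with \<open>b < a\<close>, and
  repeated generators square to \<open>1\<close>.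
\<close>

definition blade_sign :: "nat set \<Rightarrow> nat set \<Rightarrow> real" where
  "blade_sign A B = (\<Prod>a\<in>A. \<Prod>b\<in>B. if b < a then - 1 else 1)"

lemma blade_sign_empty [simp]: "blade_sign {} B = 1" "blade_sign A {} = 1"
  by (simp_all add: blade_sign_def)

lemma prod_sign_sym_diff:
  fixes h :: "'a \<Rightarrow> real"
  assumes "finite A" "finite B" "\<And>a. h a * h a = 1"
  shows "prod h (sym_diff A B) = prod h A * prod h B"
proof -
  have sq: "prod h (A \<inter> B) * prod h (A \<inter> B) = 1"
    by (simp add: prod.distrib[symmetric] assms(3))
  have 1: "prod h (sym_diff A B) = prod h (A - B) * prod h (B - A)"
    by (rule prod.union_disjoint) (use assms in auto)
  have 2: "prod h A = prod h (A \<inter> B) * prod h (A - B)"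
    using prod.Int_Diff[OF assms(1)] .
  have 3: "prod h B = prod h (A \<inter> B) * prod h (B - A)"
    using prod.Int_Diff[OF assms(2), of h A] by (simp add: Int_commute)
  have "prod h A * prod h B
      = (prod h (A \<inter> B) * prod h (A \<inter> B)) * (prod h (A - B) * prod h (B - A))"
    unfolding 2 3 by (simp only: ac_simps)
  then show ?thesis
    by (simp add: 1 sq)
qed

lemma blade_sign_sym_diff_left:
  assumes "finite A" "finite B"
  shows "blade_sign (sym_diff A B) C = blade_sign A C * blade_sign B C"
  unfolding blade_sign_def
  by (rule prod_sign_sym_diff[OF assms])
     (simp add: prod.distrib[symmetric] if_distrib cong: if_cong)

lemma blade_sign_sym_diff_right:
  assumes "finite B" "finite C"
  shows "blade_sign A (sym_diff B C) = blade_sign A B * blade_sign A C"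
  unfolding blade_sign_def prod.distrib[symmetric]
  by (intro prod.cong refl prod_sign_sym_diff[OF assms]) auto

lemma sym_diff_cancel: "sym_diff A (sym_diff A C) = C"
  by blast

instantiation clifford :: real_algebra_1
begin

lift_definition zero_clifford :: clifford is "\<lambda>_. 0"
  by simp

lift_definition one_clifford :: clifford is "\<lambda>A. if A = {} then 1 else 0"
  by simp

lift_definition plus_clifford :: "clifford \<Rightarrow> clifford \<Rightarrow> clifford" is "\<lambda>x y A. x A + y A"
proof -
  fix x y :: "nat set \<Rightarrow> real"
  assume x: "finite {A. x A \<noteq> 0} \<and> (\<forall>A. x A \<noteq> 0 \<longrightarrow> finite A)"
    and y: "finite {A. y A \<noteq> 0} \<and> (\<forall>A. y A \<noteq> 0 \<longrightarrow> finite A)"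
  have "{A. x A + y A \<noteq> 0} \<subseteq> {A. x A \<noteq> 0} \<union> {A. y A \<noteq> 0}" by auto
  then show "finite {A. x A + y A \<noteq> 0} \<and> (\<forall>A. x A + y A \<noteq> 0 \<longrightarrow> finite A)"
    using x y finite_subset by fastforce
qed

lift_definition uminus_clifford :: "clifford \<Rightarrow> clifford" is "\<lambda>x A. - x A"
  by simp

definition minus_clifford :: "clifford \<Rightarrow> clifford \<Rightarrow> clifford" where
  "minus_clifford x y = x + - y"

lift_definition scaleR_clifford :: "real \<Rightarrow> clifford \<Rightarrow> clifford" is "\<lambda>r x A. r * x A"
  by auto

text \<open>The coefficient at \<open>C\<close> collects the pairs \<open>A, B\<close> with
  \<open>A \<triangle> B = C\<close>, that is, \<open>B = A \<triangle> C\<close>.\<close>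

lift_definition times_clifford :: "clifford \<Rightarrow> clifford \<Rightarrow> clifford" is
  "\<lambda>x y C. \<Sum>A | x A \<noteq> 0. blade_sign A (sym_diff A C) * x A * y (sym_diff A C)"
proof -
  fix x y :: "nat set \<Rightarrow> real"
  assume x: "finite {A. x A \<noteq> 0} \<and> (\<forall>A. x A \<noteq> 0 \<longrightarrow> finite A)"
    and y: "finite {A. y A \<noteq> 0} \<and> (\<forall>A. y A \<noteq> 0 \<longrightarrow> finite A)"
  let ?p = "\<lambda>C. \<Sum>A | x A \<noteq> 0. blade_sign A (sym_diff A C) * x A * y (sym_diff A C)"
  let ?S = "(\<lambda>(A, B). sym_diff A B) ` ({A. x A \<noteq> 0} \<times> {A. y A \<noteq> 0})"
  have *: "C \<in> ?S" if "?p C \<noteq> 0" for C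
  proof -
    from that obtain A where "x A \<noteq> 0" "y (sym_diff A C) \<noteq> 0"
      by (auto elim!: sum.not_neutral_contains_not_neutral)
    then show ?thesis
      by (intro image_eqI[of _ _ "(A, sym_diff A C)"]) auto
  qed
  have fS: "finite ?S" using x y by simp
  have fC: "finite C" if "C \<in> ?S" for C
    using that x y by auto
  show "finite {C. ?p C \<noteq> 0} \<and> (\<forall>C. ?p C \<noteq> 0 \<longrightarrow> finite C)"
  proof (intro conjI allI impI)
    show "finite {C. ?p C \<noteq> 0}"
      by (rule finite_subset[OF _ fS]) (rule subsetI, rule *, erule CollectD)
    show "finite C" if "?p C \<noteq> 0" for C
      by (rule fC, rule *, rule that)
  qed
qed

lemma coef_times:
  assumes "finite S" "{A. coef x A \<noteq> 0} \<subseteq> S"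
  shows "coef (x * y) C = (\<Sum>A\<in>S. blade_sign A (sym_diff A C) * coef x A * coef y (sym_diff A C))"
  unfolding times_clifford.rep_eq
  by (rule sum.mono_neutral_left) (use assms in auto)

lemma coef_support:
  obtains U where "finite U" "\<And>A. coef x A \<noteq> 0 \<Longrightarrow> A \<subseteq> U"
proof -
  have "finite (\<Union>{A. coef x A \<noteq> 0})" using coef[of x] by blast
  then show ?thesis by (rule that) blast
qed

instance
proof
  fix x y z :: clifford and r q :: real
  show "x + y + z = x + (y + z)" "x + y = y + x" "0 + x = x" "- x + x = 0"
    by (transfer; simp add: fun_eq_iff)+
  show "x - y = x + - y" by (simp add: minus_clifford_def)
  show "r *\<^sub>R (x + y) = r *\<^sub>R x + r *\<^sub>R y" "(r + q) *\<^sub>R x = r *\<^sub>R x + q *\<^sub>R x"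
    "r *\<^sub>R q *\<^sub>R x = (r * q) *\<^sub>R x" "1 *\<^sub>R x = x"
    by (transfer; simp add: fun_eq_iff algebra_simps)+
  show "(0::clifford) \<noteq> 1"
    by transfer (auto simp: fun_eq_iff)
  obtain Ux where Ux: "finite Ux" "\<And>A. coef x A \<noteq> 0 \<Longrightarrow> A \<subseteq> Ux"
    using coef_support[of x] by blast
  obtain Uy where Uy: "finite Uy" "\<And>A. coef y A \<noteq> 0 \<Longrightarrow> A \<subseteq> Uy"
    using coef_support[of y] by blast
  define U where "U = Ux \<union> Uy"
  define P where "P = Pow U"
  have fU: "finite U" and fP: "finite P" using Ux Uy by (auto simp: U_def P_def)
  have xP: "{A. coef x A \<noteq> 0} \<subseteq> P" and yP: "{A. coef y A \<noteq> 0} \<subseteq> P"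
    using Ux Uy by (auto simp: U_def P_def)
  have xyP: "{A. coef (x + y) A \<noteq> 0} \<subseteq> P"
  proof
    fix A assume "A \<in> {A. coef (x + y) A \<noteq> 0}"
    then have "coef x A \<noteq> 0 \<or> coef y A \<noteq> 0" by (auto simp: plus_clifford.rep_eq)
    then show "A \<in> P" using xP yP by auto
  qed
  have xyP': "{A. coef (x * y) A \<noteq> 0} \<subseteq> P"
  proof
    fix C assume "C \<in> {A. coef (x * y) A \<noteq> 0}"
    then have "(\<Sum>A\<in>P. blade_sign A (sym_diff A C) * coef x A * coef y (sym_diff A C)) \<noteq> 0"
      using coef_times[OF fP xP] by simp
    then obtain A where "A \<in> P" "coef y (sym_diff A C) \<noteq> 0"
      by (auto elim!: sum.not_neutral_contains_not_neutral)
    then have "A \<subseteq> U" "sym_diff A C \<subseteq> U" using yP by (auto simp: P_def)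
    then show "C \<in> P" by (auto simp: P_def)
  qed
  have fin: "finite A" if "A \<in> P" for A
    using that fU by (auto simp: P_def intro: finite_subset)
  have finz: "finite A" if "coef z A \<noteq> 0" for A
    using coef[of z] that by blast
  show "(x + y) * z = x * z + y * z"
    by (simp add: coef_inject[symmetric] fun_eq_iff plus_clifford.rep_eq coef_times[OF fP xP]
        coef_times[OF fP yP] coef_times[OF fP xyP] sum.distrib[symmetric] algebra_simps)
  show "x * (y + z) = x * y + x * z"
    by (simp add: coef_inject[symmetric] fun_eq_iff plus_clifford.rep_eq coef_times[OF fP xP]
        sum.distrib[symmetric] algebra_simps)
  have rP: "{A. coef (r *\<^sub>R x) A \<noteq> 0} \<subseteq> P"
    using xP by (auto simp: scaleR_clifford.rep_eq)
  show "r *\<^sub>R x * y = r *\<^sub>R (x * y)"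
    by (simp add: coef_inject[symmetric] fun_eq_iff scaleR_clifford.rep_eq coef_times[OF fP xP]
        coef_times[OF fP rP] sum_distrib_left ac_simps)
  show "x * r *\<^sub>R y = r *\<^sub>R (x * y)"
    by (simp add: coef_inject[symmetric] fun_eq_iff scaleR_clifford.rep_eq coef_times[OF fP xP]
        sum_distrib_left ac_simps)
  have oneP: "{A. coef 1 A \<noteq> 0} \<subseteq> {{}}" by (auto simp: one_clifford.rep_eq)
  show "1 * x = x"
    by (simp add: coef_inject[symmetric] fun_eq_iff coef_times[OF _ oneP] one_clifford.rep_eq)
  show "x * 1 = x"
  proof -
    have "coef (x * 1) C = coef x C" for C
    proof -
      have "coef (x * 1) C = (\<Sum>A\<in>P. if A = C then coef x A else 0)"
        unfolding coef_times[OF fP xP] by (rule sum.cong) (auto simp: one_clifford.rep_eq)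
      also have "\<dots> = coef x C" using xP by (auto simp: fP)
      finally show ?thesis .
    qed
    then show ?thesis by (simp add: coef_inject[symmetric] fun_eq_iff)
  qed
  show "x * y * z = x * (y * z)"
  proof -
    have "coef (x * y * z) C = coef (x * (y * z)) C" for C
    proof -
      have "coef (x * y * z) C = (\<Sum>D\<in>P. \<Sum>A\<in>P. blade_sign D (sym_diff D C)
          * (blade_sign A (sym_diff A D) * coef x A * coef y (sym_diff A D)) * coef z (sym_diff D C))"
        unfolding coef_times[OF fP xyP'] coef_times[OF fP xP]
        by (simp add: sum_distrib_left sum_distrib_right)
      also have "\<dots> = (\<Sum>A\<in>P. \<Sum>D\<in>P. blade_sign D (sym_diff D C)
          * (blade_sign A (sym_diff A D) * coef x A * coef y (sym_diff A D)) * coef z (sym_diff D C))"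
        by (rule sum.swap)
      also have "\<dots> = (\<Sum>A\<in>P. \<Sum>B\<in>P. blade_sign A (sym_diff A C) * coef x A
          * (blade_sign B (sym_diff B (sym_diff A C)) * coef y B * coef z (sym_diff B (sym_diff A C))))"
      proof (rule sum.cong[OF refl])
        fix A assume A: "A \<in> P"
        show "(\<Sum>D\<in>P. blade_sign D (sym_diff D C)
          * (blade_sign A (sym_diff A D) * coef x A * coef y (sym_diff A D)) * coef z (sym_diff D C))
          = (\<Sum>B\<in>P. blade_sign A (sym_diff A C) * coef x A
          * (blade_sign B (sym_diff B (sym_diff A C)) * coef y B * coef z (sym_diff B (sym_diff A C))))"
        proof (rule sum.reindex_bij_witness[of _ "\<lambda>B. sym_diff A B" "\<lambda>D. sym_diff A D"])
          fix D assume D: "D \<in> P"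
          show "sym_diff A (sym_diff A D) = D" "sym_diff A (sym_diff A D) = D"
            by (rule sym_diff_cancel)+
          show "sym_diff A D \<in> P" "sym_diff A D \<in> P" using A D by (auto simp: P_def)
          define B where "B = sym_diff A D"
          define E where "E = sym_diff D C"
          have DD: "D = sym_diff A B" unfolding B_def by blast
          have E1: "sym_diff B (sym_diff A C) = E" unfolding B_def E_def by blast
          have E2: "sym_diff A C = sym_diff B E" unfolding B_def E_def by blast
          have fB: "finite A" "finite B" using A D fin by (auto simp: B_def)
          have "blade_sign A (sym_diff A C) * blade_sign B E = blade_sign D E * blade_sign A B"
            if "finite E"
            unfolding E2 DD blade_sign_sym_diff_left[OF fB] blade_sign_sym_diff_right[OF fB(2) that]
            by simp
          then have "blade_sign A (sym_diff A C) * coef x A * (blade_sign B E * coef y B * coef z E)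
              = blade_sign D E * (blade_sign A B * coef x A * coef y B) * coef z E"
            using finz[of E] by (cases "coef z E = 0") (auto simp: ac_simps)
          then show "blade_sign A (sym_diff A C) * coef x A
             * (blade_sign (sym_diff A D) (sym_diff (sym_diff A D) (sym_diff A C)) * coef y (sym_diff A D)
                * coef z (sym_diff (sym_diff A D) (sym_diff A C)))
             = blade_sign D (sym_diff D C)
             * (blade_sign A (sym_diff A D) * coef x A * coef y (sym_diff A D)) * coef z (sym_diff D C)"
            unfolding B_def[symmetric] E1 unfolding E_def .
        qed
      qed
      also have "\<dots> = coef (x * (y * z)) C"
        unfolding coef_times[OF fP xP] coef_times[OF fP yP] by (simp add: sum_distrib_left)
      finally show ?thesis .
    qed
    then show ?thesis by (simp add: coef_inject[symmetric] fun_eq_iff)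
  qed
qed

end

lift_definition blade :: "nat set \<Rightarrow> clifford" is "\<lambda>A B. if finite A \<and> B = A then 1 else 0"
  by simp

definition clifford_gen :: "nat \<Rightarrow> clifford" where
  "clifford_gen j = blade {j}"

lemma blade_empty: "blade {} = 1"
  by (simp add: coef_inject[symmetric] fun_eq_iff blade.rep_eq one_clifford.rep_eq)

lemma blade_times:
  assumes "finite A" "finite B"
  shows "blade A * blade B = blade_sign A B *\<^sub>R blade (sym_diff A B)"
proof -
  have s: "{D. coef (blade A) D \<noteq> 0} \<subseteq> {A}" by (auto simp: blade.rep_eq)
  have "coef (blade A * blade B) C = coef (blade_sign A B *\<^sub>R blade (sym_diff A B)) C" for C
  proof -
    have "sym_diff A C = B \<longleftrightarrow> C = sym_diff A B" by blast
    then show ?thesis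
      using assms by (auto simp: coef_times[OF _ s] scaleR_clifford.rep_eq blade.rep_eq)
  qed
  then show ?thesis by (simp add: coef_inject[symmetric] fun_eq_iff)
qed

lemma clifford_gen_square: "clifford_gen j * clifford_gen j = 1"
  by (simp add: clifford_gen_def blade_times blade_sign_def blade_empty)

lemma clifford_gen_anticommute:
  assumes "i \<noteq> j"
  shows "clifford_gen i * clifford_gen j = - (clifford_gen j * clifford_gen i)"
proof -
  have "sym_diff {i} {j} = sym_diff {j} {i}" by blast
  moreover have "blade_sign {i} {j} = - blade_sign {j} {i}"
    using assms by (auto simp: blade_sign_def)
  ultimately show ?thesis
    by (simp only: clifford_gen_def blade_times finite.intros scaleR_minus_left)
qed

inductive_set subalgebra_gen :: "'a::real_algebra_1 set \<Rightarrow> 'a set" for S where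
  gen: "x \<in> S \<Longrightarrow> x \<in> subalgebra_gen S"
| one: "1 \<in> subalgebra_gen S"
| scaleR: "x \<in> subalgebra_gen S \<Longrightarrow> r *\<^sub>R x \<in> subalgebra_gen S"
| add: "x \<in> subalgebra_gen S \<Longrightarrow> y \<in> subalgebra_gen S \<Longrightarrow> x + y \<in> subalgebra_gen S"
| mult: "x \<in> subalgebra_gen S \<Longrightarrow> y \<in> subalgebra_gen S \<Longrightarrow> x * y \<in> subalgebra_gen S"

definition clifford_alg :: "nat \<Rightarrow> clifford set" where
  "clifford_alg m = subalgebra_gen (clifford_gen ` {1..m})"

lemma coef_sum: "coef (sum g S) A = (\<Sum>k\<in>S. coef (g k) A)"
  by (induction S rule: infinite_finite_induct)
     (auto simp: zero_clifford.rep_eq plus_clifford.rep_eq)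

lemma clifford_expand: "x = (\<Sum>A | coef x A \<noteq> 0. coef x A *\<^sub>R blade A)"
proof -
  have f: "finite {A. coef x A \<noteq> 0}" and f': "coef x A \<noteq> 0 \<Longrightarrow> finite A" for A
    using coef[of x] by blast+
  have "coef (\<Sum>A | coef x A \<noteq> 0. coef x A *\<^sub>R blade A) C = coef x C" for C
  proof -
    have "(\<Sum>A | coef x A \<noteq> 0. coef (coef x A *\<^sub>R blade A) C)
        = (\<Sum>A | coef x A \<noteq> 0. if A = C then coef x A else 0)"
      by (rule sum.cong) (auto simp: scaleR_clifford.rep_eq blade.rep_eq f')
    then show ?thesis using f by (simp add: coef_sum)
  qed
  then have "coef (\<Sum>A | coef x A \<noteq> 0. coef x A *\<^sub>R blade A) = coef x" by (rule ext)
  then show ?thesis by (simp only: coef_inject)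
qed

lemma blade_in_clifford_alg:
  assumes "A \<subseteq> {1..m}"
  shows "blade A \<in> clifford_alg m"
proof -
  have "finite A" using assms by (rule finite_subset) simp
  then show ?thesis using assms
  proof (induction A rule: finite_linorder_min_induct)
    case empty
    show ?case by (simp add: blade_empty clifford_alg_def subalgebra_gen.one)
  next
    case (insert a A)
    then have "a \<notin> A" by auto
    moreover have "(\<Prod>b\<in>A. if b < a then - 1 else 1 :: real) = 1"
      by (rule prod.neutral) (use insert in auto)
    ultimately have "blade (insert a A) = clifford_gen a * blade A"
      using insert by (simp add: clifford_gen_def blade_times blade_sign_def insert_Diff_if)
    then show ?case
      using insert by (auto simp: clifford_alg_def intro: subalgebra_gen.mult[OF subalgebra_gen.gen])
  qed
qed

lemma clifford_alg_eq:
  "clifford_alg m = {x. \<forall>A. coef x A \<noteq> 0 \<longrightarrow> A \<subseteq> {1..m}}"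
proof (intro equalityI subsetI)
  fix x assume "x \<in> clifford_alg m"
  then have "x \<in> subalgebra_gen (clifford_gen ` {1..m})" by (simp add: clifford_alg_def)
  then show "x \<in> {x. \<forall>A. coef x A \<noteq> 0 \<longrightarrow> A \<subseteq> {1..m}}"
  proof induction
    case (gen x)
    then show ?case by (auto simp: clifford_gen_def blade.rep_eq split: if_splits)
  next
    case one
    then show ?case by (auto simp: one_clifford.rep_eq)
  next
    case (scaleR x r)
    then show ?case by (auto simp: scaleR_clifford.rep_eq)
  next
    case (add x y)
    have "A \<subseteq> {1..m}" if "coef (x + y) A \<noteq> 0" for A
    proof -
      have "coef x A \<noteq> 0 \<or> coef y A \<noteq> 0" using that by (auto simp: plus_clifford.rep_eq)
      then show ?thesis using add by blast
    qed
    then show ?case by blast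
  next
    case (mult x y)
    have "C \<subseteq> {1..m}" if "coef (x * y) C \<noteq> 0" for C
    proof -
      from that obtain A where "coef x A \<noteq> 0" "coef y (sym_diff A C) \<noteq> 0"
        unfolding times_clifford.rep_eq
        by (auto elim!: sum.not_neutral_contains_not_neutral)
      then have "A \<subseteq> {1..m}" "sym_diff A C \<subseteq> {1..m}" using mult.IH by blast+
      then show ?thesis by blast
    qed
    then show ?case by blast
  qed
next
  fix x assume x: "x \<in> {x. \<forall>A. coef x A \<noteq> 0 \<longrightarrow> A \<subseteq> {1..m}}"
  have zero: "0 \<in> clifford_alg m"
    using subalgebra_gen.scaleR[OF subalgebra_gen.one, of 0] by (simp add: clifford_alg_def)
  have sum: "sum g S \<in> clifford_alg m" if "\<And>k. k \<in> S \<Longrightarrow> g k \<in> clifford_alg m"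
    for S :: "nat set set" and g
    using that
  proof (induction S rule: infinite_finite_induct)
    case (insert k S)
    have "g k \<in> clifford_alg m" "sum g S \<in> clifford_alg m"
      using insert by simp_all
    then show ?case
      unfolding sum.insert[OF insert.hyps] clifford_alg_def by (rule subalgebra_gen.add)
  qed (simp_all add: zero)
  have "(\<Sum>A | coef x A \<noteq> 0. coef x A *\<^sub>R blade A) \<in> clifford_alg m"
  proof (rule sum)
    fix A assume "A \<in> {A. coef x A \<noteq> 0}"
    then have "blade A \<in> clifford_alg m" using x blade_in_clifford_alg by auto
    then show "coef x A *\<^sub>R blade A \<in> clifford_alg m"
      by (auto simp: clifford_alg_def intro: subalgebra_gen.scaleR)
  qed
  then show "x \<in> clifford_alg m" by (subst clifford_expand)
qed

text \<open>
  In the algebra on \<open>2 n + 2\<close> generators, \<open>e\<^sub>j = clifford_gen j\<close> for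
  \<open>1 \<le> j \<le> 2 n\<close>, and \<open>r\<^sub>1\<close>, \<open>r\<^sub>2\<close> are the last two generators.
\<close>

definition qra_iota :: "nat \<Rightarrow> clifford" where
  "qra_iota n = clifford_gen (2 * n + 1) * clifford_gen (2 * n + 2)"

definition qra_complex :: "nat \<Rightarrow> clifford set" where
  "qra_complex n = {of_real a + of_real b * qra_iota n | a b. True}"

definition QRA :: "nat \<Rightarrow> clifford set" where
  "QRA n = {\<Sum>k<m. c k * g k | (m::nat) c g.
     (\<forall>k<m. c k \<in> qra_complex n \<and> g k \<in> clifford_alg (2 * n))}"

definition qra_f :: "nat \<Rightarrow> nat \<Rightarrow> clifford" where
  "qra_f n i = (1/2) *\<^sub>R (clifford_gen i + qra_iota n * clifford_gen (i + n))"

definition qra_fd :: "nat \<Rightarrow> nat \<Rightarrow> clifford" where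
  "qra_fd n i = (1/2) *\<^sub>R (clifford_gen i - qra_iota n * clifford_gen (i + n))"

definition qra_I :: "nat \<Rightarrow> clifford" where
  "qra_I n = prod_list (map (\<lambda>i. qra_f n i * qra_fd n i) [1..<n+1])"

definition bit_strings :: "nat \<Rightarrow> (nat \<Rightarrow> nat) set" where
  "bit_strings n = {1..n} \<rightarrow>\<^sub>E {0, 1}"

definition ket :: "nat \<Rightarrow> (nat \<Rightarrow> nat) \<Rightarrow> clifford" where
  "ket n a = prod_list (map (\<lambda>i. qra_fd n i ^ a i) [1..<n+1]) * qra_I n"

definition qubits :: "nat \<Rightarrow> clifford set" where
  "qubits n = {\<Sum>a\<in>bit_strings n. c a * ket n a | c. c \<in> bit_strings n \<rightarrow> qra_complex n}"

definition swap_bits :: "nat \<Rightarrow> nat \<Rightarrow> (nat \<Rightarrow> nat) \<Rightarrow> nat \<Rightarrow> nat" where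
  "swap_bits s t a = a \<circ> transpose s t"

definition SWAP_succ :: "nat \<Rightarrow> nat \<Rightarrow> clifford" where
  "SWAP_succ n s =
     qra_f n s * qra_fd n s * qra_f n (s + 1) * qra_fd n (s + 1)
     - qra_f n s * qra_fd n (s + 1)
     + qra_fd n s * qra_f n (s + 1)
     + qra_fd n s * qra_f n s * qra_fd n (s + 1) * qra_f n (s + 1)"

end

theory Submission
  imports Defs
begin

text \<open>
  The elements \<open>f\<^sub>i\<close>, \<open>f\<^sub>i\<^sup>\<dagger>\<close> satisfy the canonical anticommutation relations and
  \<open>f\<^sub>i I = 0\<close>. Every term of \<open>SWAP(s, s + 1)\<close> is even in
  \<open>f\<^sub>s, f\<^sub>s\<^sup>\<dagger>, f\<^bsub>s+1\<^esub>, f\<^bsub>s+1\<^esub>\<^sup>\<dagger>\<close>, so it commutes with the creation operators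
  to the left of position \<open>s\<close>, while the factor \<open>R\<close> to the right of position \<open>s + 1\<close>
  (including \<open>I\<close>) is annihilated by \<open>f\<^sub>s\<close> and \<open>f\<^bsub>s+1\<^esub>\<close>. What remains is a
  calculation for two fermionic modes acting on the vacuum \<open>R\<close>. Linearity over the complex
  scalars holds because \<open>\<iota>\<close> is central in \<open>QRA(n)\<close>.
\<close>

section \<open>Anticommuting elements of a ring\<close>

lemma commute_mult_if_anticommute:
  fixes x p q :: "'a::ring"
  assumes "x * p = - (p * x)" and "x * q = - (q * x)"
  shows "x * (p * q) = p * q * x"
proof -
  have "x * (p * q) = - (p * (x * q))"
    by (simp add: mult.assoc[symmetric] assms(1))
  then show ?thesis
    by (simp add: assms(2) mult.assoc)
qed

lemma prod_list_commute_left: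
  fixes w :: "'a::monoid_mult"
  assumes "\<And>x. x \<in> set xs \<Longrightarrow> w * x = x * w"
  shows "w * prod_list xs = prod_list xs * w"
  using assms
proof (induction xs)
  case (Cons x xs)
  have "w * (x * prod_list xs) = x * (w * prod_list xs)"
    using Cons.prems by (simp add: mult.assoc[symmetric])
  then show ?case using Cons by (simp add: mult.assoc)
qed simp

text \<open>\<open>w\<close> travels right through the list until it meets \<open>y\<close>. Each
  factor costs at most a sign, and the signs need no bookkeeping because the final value is
  zero.\<close>

lemma mult_prod_list_eq_0:
  fixes w y :: "'a::ring_1"
  assumes "\<And>x. x \<in> set xs \<Longrightarrow> w * x = x * w \<or> w * x = - (x * w)" and "w * y = 0"
  shows "w * (prod_list xs * y) = 0"
  using assms(1)
proof (induction xs)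
  case Nil
  then show ?case by (simp add: assms(2))
next
  case (Cons x xs)
  have IH: "w * (prod_list xs * y) = 0"
    using Cons by simp
  from Cons.prems consider "w * x = x * w" | "w * x = - (x * w)"
    by auto
  then have "w * x * (prod_list xs * y) = 0"
    by cases (simp_all only: mult.assoc IH mult_minus_left mult_zero_right minus_zero)
  then show ?case by (simp add: mult.assoc)
qed

text \<open>The sign is the parity of \<open>k\<close>. Leaving it as a disjunction matches the
  premise of \<open>mult_prod_list_eq_0\<close>.\<close>

lemma power_commute_or_anticommute:
  fixes w x :: "'a::ring_1"
  assumes "w * x = - (x * w)"
  shows "w * x ^ k = x ^ k * w \<or> w * x ^ k = - (x ^ k * w)"
proof (induction k)
  case (Suc k)
  have "w * x ^ Suc k = - (x * (w * x ^ k))"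
    by (simp add: mult.assoc[symmetric] assms)
  then show ?case using Suc by (auto simp: mult.assoc)
qed simp

lemma power_commute:
  fixes w x :: "'a::monoid_mult"
  assumes "w * x = x * w"
  shows "w * x ^ k = x ^ k * w"
  using power_commuting_commutes[of x w k] assms by simp

text \<open>The four equations cover the four occupations of two modes over the vacuum
  \<open>R\<close>. The minus sign in front of \<open>f * G\<close> cancels the one from
  \<open>G * F = - (F * G)\<close> when the first mode is occupied.\<close>

lemma two_mode_swap:
  fixes f F g G R :: "'a::ring_1"
  assumes FF: "F * F = 0" and GG: "G * G = 0"
    and fF: "f * F = 1 - F * f" and gG: "g * G = 1 - G * g"
    and gf: "g * f = - (f * g)" and gF: "g * F = - (F * g)"
    and fG: "f * G = - (G * f)" and GF: "G * F = - (F * G)"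
    and fR: "f * R = 0" and gR: "g * R = 0"
    and W: "W = f * F * g * G - f * G + F * g + F * f * G * g"
  shows "W * R = R" "W * (F * R) = G * R" "W * (G * R) = F * R" "W * (F * (G * R)) = F * (G * R)"
proof -
  \<comment> \<open>The trailing \<open>x\<close> lets these rules rewrite right-nested products.
    They sort factors into the order \<open>F\<close>, \<open>G\<close>, \<open>f\<close>,
    \<open>g\<close>, which brings the annihilators next to \<open>R\<close>.\<close>
  have normal_order:
    "F * (F * x) = 0" "G * (G * x) = 0" "f * (F * x) = x - F * (f * x)" "g * (G * x) = x - G * (g * x)"
    "g * (f * x) = - (f * (g * x))" "g * (F * x) = - (F * (g * x))"
    "f * (G * x) = - (G * (f * x))" "G * (F * x) = - (F * (G * x))" for x
    by (simp_all add: mult.assoc[symmetric] FF GG fF gG gf gF fG GF left_diff_distrib)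
  show "W * R = R" "W * (F * R) = G * R" "W * (G * R) = F * R" "W * (F * (G * R)) = F * (G * R)"
    by (simp_all add: W distrib_right left_diff_distrib right_diff_distrib mult.assoc
        normal_order fR gR)
qed

section \<open>The complexified Clifford algebra\<close>

lemma qra_iota_square: "qra_iota n * qra_iota n = - 1"
proof -
  let ?a = "clifford_gen (2 * n + 1)" and ?b = "clifford_gen (2 * n + 2)"
  have "?a * ?b * (?a * ?b) = ?a * (?b * ?a) * ?b"
    by (simp only: mult.assoc)
  also have "?b * ?a = - (?a * ?b)"
    by (rule clifford_gen_anticommute) simp
  also have "?a * - (?a * ?b) * ?b = - (?a * ?a * (?b * ?b))"
    by (simp add: mult.assoc)
  finally show ?thesis by (simp add: qra_iota_def clifford_gen_square)
qed

lemma qra_iota_commute_gen: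
  assumes "j \<le> 2 * n"
  shows "clifford_gen j * qra_iota n = qra_iota n * clifford_gen j"
  unfolding qra_iota_def
  by (intro commute_mult_if_anticommute clifford_gen_anticommute) (use assms in auto)

lemma qra_iota_commute_clifford_alg:
  assumes "x \<in> clifford_alg (2 * n)"
  shows "x * qra_iota n = qra_iota n * x"
  using assms unfolding clifford_alg_def
proof induction
  case (gen x)
  then show ?case by (auto simp: qra_iota_commute_gen)
next
  case (mult x y)
  then show ?case by (metis mult.assoc)
qed (simp_all add: distrib_left distrib_right)

text \<open>The real and imaginary parts of an element of \<open>QRA n\<close>. Products and
  commutation with scalars are easier to control in this two-term form than for sums of arbitrary
  length.\<close>

definition qra_pairs :: "nat \<Rightarrow> clifford set" where
  "qra_pairs n = {x + qra_iota n * y | x y. x \<in> clifford_alg (2 * n) \<and> y \<in> clifford_alg (2 * n)}"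

lemma clifford_alg_closed:
  "x \<in> clifford_alg m \<Longrightarrow> y \<in> clifford_alg m \<Longrightarrow> x + y \<in> clifford_alg m"
  "x \<in> clifford_alg m \<Longrightarrow> y \<in> clifford_alg m \<Longrightarrow> x * y \<in> clifford_alg m"
  "x \<in> clifford_alg m \<Longrightarrow> r *\<^sub>R x \<in> clifford_alg m"
  "x \<in> clifford_alg m \<Longrightarrow> - x \<in> clifford_alg m"
  "x \<in> clifford_alg m \<Longrightarrow> y \<in> clifford_alg m \<Longrightarrow> x - y \<in> clifford_alg m"
proof -
  have add: "x + y \<in> clifford_alg m" if "x \<in> clifford_alg m" "y \<in> clifford_alg m" for x y
    using that unfolding clifford_alg_def by (rule subalgebra_gen.add)
  have scaleR: "r *\<^sub>R x \<in> clifford_alg m" if "x \<in> clifford_alg m" for x r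
    using that unfolding clifford_alg_def by (rule subalgebra_gen.scaleR)
  have uminus: "- x \<in> clifford_alg m" if "x \<in> clifford_alg m" for x
    using scaleR[OF that, of "- 1"] by simp
  show "x \<in> clifford_alg m \<Longrightarrow> y \<in> clifford_alg m \<Longrightarrow> x + y \<in> clifford_alg m"
    by (rule add)
  show "x \<in> clifford_alg m \<Longrightarrow> y \<in> clifford_alg m \<Longrightarrow> x * y \<in> clifford_alg m"
    unfolding clifford_alg_def by (rule subalgebra_gen.mult)
  show "x \<in> clifford_alg m \<Longrightarrow> r *\<^sub>R x \<in> clifford_alg m"
    by (rule scaleR)
  show "x \<in> clifford_alg m \<Longrightarrow> - x \<in> clifford_alg m"
    by (rule uminus)
  show "x \<in> clifford_alg m \<Longrightarrow> y \<in> clifford_alg m \<Longrightarrow> x - y \<in> clifford_alg m"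
    using add[OF _ uminus, of x y] by simp
qed

text \<open>This is complex multiplication with noncommuting coefficients: \<open>qra_iota n\<close>
  moves left past \<open>x1\<close> and \<open>x2\<close>, and its square is -1.\<close>

lemma qra_pair_times:
  assumes "x2 * qra_iota n = qra_iota n * x2" "x1 * qra_iota n = qra_iota n * x1"
  shows "(x1 + qra_iota n * x2) * (y1 + qra_iota n * y2)
    = (x1 * y1 - x2 * y2) + qra_iota n * (x1 * y2 + x2 * y1)"
proof -
  have 1: "x1 * (qra_iota n * y2) = qra_iota n * (x1 * y2)"
    by (simp add: mult.assoc[symmetric] assms)
  have "qra_iota n * x2 * (qra_iota n * y2) = qra_iota n * (x2 * qra_iota n) * y2"
    by (simp only: mult.assoc)
  also have "\<dots> = qra_iota n * qra_iota n * (x2 * y2)"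
    by (simp only: assms mult.assoc)
  finally have 2: "qra_iota n * x2 * (qra_iota n * y2) = - (x2 * y2)"
    by (simp add: qra_iota_square)
  show ?thesis
    by (simp add: distrib_left distrib_right 1 2 mult.assoc[of "qra_iota n" x2 y1])
qed

lemma qra_pairs_add:
  assumes "x \<in> qra_pairs n" "y \<in> qra_pairs n"
  shows "x + y \<in> qra_pairs n"
proof -
  from assms obtain x1 x2 y1 y2 where
    xy: "x = x1 + qra_iota n * x2" "y = y1 + qra_iota n * y2"
    and mem: "{x1, x2, y1, y2} \<subseteq> clifford_alg (2 * n)"
    unfolding qra_pairs_def by auto
  have "x + y = (x1 + y1) + qra_iota n * (x2 + y2)"
    by (simp add: xy distrib_left)
  moreover have "x1 + y1 \<in> clifford_alg (2 * n)" "x2 + y2 \<in> clifford_alg (2 * n)"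
    using mem by (simp_all add: clifford_alg_closed)
  ultimately show ?thesis unfolding qra_pairs_def by blast
qed

lemma qra_pairs_diff:
  assumes "x \<in> qra_pairs n" "y \<in> qra_pairs n"
  shows "x - y \<in> qra_pairs n"
proof -
  from assms obtain x1 x2 y1 y2 where
    xy: "x = x1 + qra_iota n * x2" "y = y1 + qra_iota n * y2"
    and mem: "{x1, x2, y1, y2} \<subseteq> clifford_alg (2 * n)"
    unfolding qra_pairs_def by auto
  have "x - y = (x1 - y1) + qra_iota n * (x2 - y2)"
    by (simp add: xy right_diff_distrib)
  moreover have "x1 - y1 \<in> clifford_alg (2 * n)" "x2 - y2 \<in> clifford_alg (2 * n)"
    using mem by (simp_all add: clifford_alg_closed)
  ultimately show ?thesis unfolding qra_pairs_def by blast
qed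

lemma qra_pairs_mult:
  assumes "x \<in> qra_pairs n" "y \<in> qra_pairs n"
  shows "x * y \<in> qra_pairs n"
proof -
  from assms obtain x1 x2 y1 y2 where
    xy: "x = x1 + qra_iota n * x2" "y = y1 + qra_iota n * y2"
    and mem: "{x1, x2, y1, y2} \<subseteq> clifford_alg (2 * n)"
    unfolding qra_pairs_def by auto
  have "x * y = (x1 * y1 - x2 * y2) + qra_iota n * (x1 * y2 + x2 * y1)"
    unfolding xy by (intro qra_pair_times qra_iota_commute_clifford_alg) (use mem in auto)
  moreover have "x1 * y1 - x2 * y2 \<in> clifford_alg (2 * n)" "x1 * y2 + x2 * y1 \<in> clifford_alg (2 * n)"
    using mem by (simp_all add: clifford_alg_closed)
  ultimately show ?thesis unfolding qra_pairs_def by blast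
qed

lemma qra_pairs_subset_QRA: "qra_pairs n \<subseteq> QRA n"
proof
  fix z assume "z \<in> qra_pairs n"
  then obtain x y where z: "z = x + qra_iota n * y"
    and mem: "x \<in> clifford_alg (2 * n)" "y \<in> clifford_alg (2 * n)"
    unfolding qra_pairs_def by auto
  define c where "c = (\<lambda>k::nat. if k = 0 then 1 else qra_iota n)"
  define g where "g = (\<lambda>k::nat. if k = 0 then x else y)"
  have "1 = of_real 1 + of_real 0 * qra_iota n" "qra_iota n = of_real 0 + of_real 1 * qra_iota n"
    by simp_all
  then have "1 \<in> qra_complex n" "qra_iota n \<in> qra_complex n"
    unfolding qra_complex_def by blast+
  then have "\<forall>k<2. c k \<in> qra_complex n \<and> g k \<in> clifford_alg (2 * n)"
    using mem by (simp add: c_def g_def)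
  moreover have "z = (\<Sum>k<2. c k * g k)"
    by (simp add: z c_def g_def numeral_2_eq_2)
  ultimately show "z \<in> QRA n" unfolding QRA_def by blast
qed

text \<open>Real scalars are central, so everything reduces to moving \<open>qra_iota n\<close> past
  both parts of \<open>x\<close>.\<close>

lemma qra_complex_commute_qra_pairs:
  assumes "c \<in> qra_complex n" "x \<in> qra_pairs n"
  shows "x * c = c * x"
proof -
  from assms(2) obtain x1 x2 where x: "x = x1 + qra_iota n * x2"
    and mem: "x1 \<in> clifford_alg (2 * n)" "x2 \<in> clifford_alg (2 * n)"
    unfolding qra_pairs_def by auto
  have iota: "x * qra_iota n = qra_iota n * x"
    using mem[THEN qra_iota_commute_clifford_alg] by (simp add: x distrib_left distrib_right mult.assoc)
  from assms(1) obtain a b where c: "c = of_real a + of_real b * qra_iota n"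
    unfolding qra_complex_def by auto
  show ?thesis
    by (simp add: c distrib_left distrib_right of_real_def iota)
qed

section \<open>Canonical anticommutation relations\<close>

text \<open>In this form \<open>qra_f\<close> and \<open>qra_fd\<close> differ only in the
  coefficient 1/2 or -1/2 of the imaginary part.\<close>

lemma qra_f_eq: "qra_f n i = (1/2) *\<^sub>R clifford_gen i + qra_iota n * ((1/2) *\<^sub>R clifford_gen (i + n))"
  by (simp add: qra_f_def scaleR_right_distrib)

lemma qra_fd_eq: "qra_fd n i = (1/2) *\<^sub>R clifford_gen i + qra_iota n * ((-1/2) *\<^sub>R clifford_gen (i + n))"
  by (simp add: qra_fd_def scaleR_right_diff_distrib)

lemma qra_f_in_qra_pairs:
  assumes "i \<in> {1..n}"
  shows "qra_f n i \<in> qra_pairs n" "qra_fd n i \<in> qra_pairs n"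
proof -
  have "clifford_gen i \<in> clifford_alg (2 * n)" "clifford_gen (i + n) \<in> clifford_alg (2 * n)"
    using assms unfolding clifford_alg_def by (auto intro!: subalgebra_gen.gen)
  then show "qra_f n i \<in> qra_pairs n" "qra_fd n i \<in> qra_pairs n"
    unfolding qra_pairs_def qra_f_eq qra_fd_eq by (blast intro: clifford_alg_closed)+
qed

text \<open>One calculation serves all three relations, with \<open>p\<close> and \<open>q\<close>
  equal to 1/2 or -1/2. For \<open>i = j\<close> the mixed terms cancel and the squares give 2 (1/4
  - p q), which is 0 for equal signs and 1 for opposite signs.\<close>

lemma qra_linear_anticommutator:
  assumes "i \<in> {1..n}" "j \<in> {1..n}"
  shows "((1/2) *\<^sub>R clifford_gen i + qra_iota n * (p *\<^sub>R clifford_gen (i + n)))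
        * ((1/2) *\<^sub>R clifford_gen j + qra_iota n * (q *\<^sub>R clifford_gen (j + n)))
      + ((1/2) *\<^sub>R clifford_gen j + qra_iota n * (q *\<^sub>R clifford_gen (j + n)))
        * ((1/2) *\<^sub>R clifford_gen i + qra_iota n * (p *\<^sub>R clifford_gen (i + n)))
      = (if i = j then (1/2 - 2 * p * q) *\<^sub>R 1 else 0)"
proof -
  have le: "i \<le> 2 * n" "j \<le> 2 * n" "i + n \<le> 2 * n" "j + n \<le> 2 * n"
    using assms by auto
  \<comment> \<open>Here \<open>i\<close> and \<open>j + n\<close> differ even when
    \<open>i = j\<close>, since \<open>i\<close> is at most \<open>n\<close> and \<open>j\<close> is
    positive.\<close>
  have ij: "clifford_gen i * clifford_gen (j + n) = - (clifford_gen (j + n) * clifford_gen i)"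
    "clifford_gen j * clifford_gen (i + n) = - (clifford_gen (i + n) * clifford_gen j)"
    using assms by (auto intro!: clifford_gen_anticommute)
  have neq: "clifford_gen i * clifford_gen j = - (clifford_gen j * clifford_gen i)"
    "clifford_gen (i + n) * clifford_gen (j + n) = - (clifford_gen (j + n) * clifford_gen (i + n))"
    if "i \<noteq> j"
    using that by (auto intro!: clifford_gen_anticommute)
  have comm: "(r *\<^sub>R clifford_gen k) * qra_iota n = qra_iota n * (r *\<^sub>R clifford_gen k)"
    if "k \<le> 2 * n" for r k
    using that by (simp add: qra_iota_commute_gen)
  note products = qra_pair_times[OF comm[OF le(3)] comm[OF le(1)]]
    qra_pair_times[OF comm[OF le(4)] comm[OF le(2)]]
  show ?thesis
  proof (cases "i = j")
    case True
    have "(1/4) *\<^sub>R x + (1/4) *\<^sub>R x = (1/2) *\<^sub>R x" for x :: clifford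
      by (simp flip: scaleR_left_distrib)
    then show ?thesis
      unfolding products using ij True
      by (simp add: clifford_gen_square algebra_simps flip: scaleR_2)
  next
    case False
    then show ?thesis
      unfolding products by (simp add: ij neq algebra_simps)
  qed
qed

lemma qra_anticommutator:
  assumes "i \<in> {1..n}" "j \<in> {1..n}"
  shows "qra_f n i * qra_f n j + qra_f n j * qra_f n i = 0"
    "qra_fd n i * qra_fd n j + qra_fd n j * qra_fd n i = 0"
    "qra_f n i * qra_fd n j + qra_fd n j * qra_f n i = (if i = j then 1 else 0)"
  unfolding qra_f_eq qra_fd_eq qra_linear_anticommutator[OF assms] by simp_all

lemma qra_f_square:
  assumes "i \<in> {1..n}"
  shows "qra_f n i * qra_f n i = 0" "qra_fd n i * qra_fd n i = 0"
proof -
  have "x = 0" if "x + x = 0" for x :: clifford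
    using that by (simp flip: scaleR_2)
  then show "qra_f n i * qra_f n i = 0" "qra_fd n i * qra_fd n i = 0"
    using qra_anticommutator(1,2)[OF assms assms] by blast+
qed

lemma qra_f_qra_fd_same:
  assumes "i \<in> {1..n}"
  shows "qra_f n i * qra_fd n i = 1 - qra_fd n i * qra_f n i"
  using qra_anticommutator(3)[OF assms assms] by (simp add: eq_diff_eq)

lemma qra_f_anticommute:
  assumes "i \<in> {1..n}" "j \<in> {1..n}" "i \<noteq> j"
  shows "qra_f n i * qra_f n j = - (qra_f n j * qra_f n i)"
    "qra_fd n i * qra_fd n j = - (qra_fd n j * qra_fd n i)"
    "qra_f n i * qra_fd n j = - (qra_fd n j * qra_f n i)"
    "qra_fd n i * qra_f n j = - (qra_f n j * qra_fd n i)"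
  using qra_anticommutator[OF assms(1,2)] qra_anticommutator(3)[OF assms(2,1)] assms(3)
  by (simp_all add: eq_neg_iff_add_eq_0 add.commute)

text \<open>The annihilator commutes with the pairs of all earlier modes, and on reaching its own
  pair it produces the vanishing square of \<open>qra_f n i\<close>.\<close>

lemma qra_f_qra_I:
  assumes "i \<in> {1..n}"
  shows "qra_f n i * qra_I n = 0"
proof -
  let ?p = "\<lambda>k. qra_f n k * qra_fd n k"
  have "[1..<n+1] = [1..<i] @ i # [i+1..<n+1]"
    using assms by (metis atLeastAtMost_iff le_add_diff_inverse upt_add_eq_append upt_conv_Cons
        le_SucI Suc_eq_plus1 less_Suc_eq_le)
  then have "qra_I n = prod_list (map ?p [1..<i]) * (?p i * prod_list (map ?p [i+1..<n+1]))"
    unfolding qra_I_def by (simp only: map_append list.map prod_list.append prod_list.Cons)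
  also have "qra_f n i * \<dots> = 0"
  proof (rule mult_prod_list_eq_0)
    show "qra_f n i * (?p i * prod_list (map ?p [i+1..<n+1])) = 0"
      by (simp only: mult.assoc[symmetric] qra_f_square[OF assms] mult_zero_left)
    fix x assume "x \<in> set (map ?p [1..<i])"
    then obtain k where k: "x = ?p k" "k \<in> {1..n}" "k \<noteq> i"
      using assms by auto
    have "qra_f n i * x = x * qra_f n i"
      unfolding k(1) using assms k by (intro commute_mult_if_anticommute qra_f_anticommute) auto
    then show "qra_f n i * x = x * qra_f n i \<or> qra_f n i * x = - (x * qra_f n i)" ..
  qed
  finally show ?thesis .
qed

section \<open>Action of the swap element on basis states and qubits\<close>

lemma SWAP_succ_commute_qra_fd:
  assumes "1 \<le> s" "s < n" "i \<in> {1..n}" "i \<noteq> s" "i \<noteq> s + 1"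
  shows "SWAP_succ n s * qra_fd n i = qra_fd n i * SWAP_succ n s"
proof -
  let ?x = "qra_fd n i"
  have s: "s \<in> {1..n}" "s + 1 \<in> {1..n}" using assms by auto
  note anti = qra_f_anticommute(2,4)[OF assms(3) s(1) assms(4)]
    qra_f_anticommute(2,4)[OF assms(3) s(2) assms(5)]
  have pairs: "?x * (p * q) = p * q * ?x"
    if "p \<in> {qra_f n s, qra_fd n s, qra_f n (s+1), qra_fd n (s+1)}"
      "q \<in> {qra_f n s, qra_fd n s, qra_f n (s+1), qra_fd n (s+1)}" for p q
    using that anti by (intro commute_mult_if_anticommute) auto
  have quad: "?x * (u * v) = u * v * ?x" if "?x * u = u * ?x" "?x * v = v * ?x" for u v
    using that by (metis mult.assoc)
  \<comment> \<open>The quartic terms are regrouped as products of two quadratic ones, so that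
    \<open>quad\<close> reduces them to \<open>pairs\<close>.\<close>
  have "?x * SWAP_succ n s = SWAP_succ n s * ?x"
    unfolding SWAP_succ_def distrib_left distrib_right right_diff_distrib left_diff_distrib
      mult.assoc[of "_ * _" "qra_f n (s+1)"] mult.assoc[of "_ * _" "qra_fd n (s+1)"]
    by (intro arg_cong2[where f = "(+)"] arg_cong2[where f = "(-)"] quad pairs) auto
  then show ?thesis by simp
qed

lemma SWAP_succ_ket:
  assumes s: "1 \<le> s" "s < n" and a: "a \<in> bit_strings n"
  shows "SWAP_succ n s * ket n a = ket n (swap_bits s (s + 1) a)"
proof -
  define W where "W = SWAP_succ n s"
  define F where "F = qra_fd n"
  define pre where "pre = prod_list (map (\<lambda>i. F i ^ a i) [1..<s])"
  define R where "R = prod_list (map (\<lambda>i. F i ^ a i) [s+2..<n+1]) * qra_I n"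
  have sn: "s \<in> {1..n}" "s + 1 \<in> {1..n}" and neq: "s + 1 \<noteq> s" using s by auto
  have split: "[1..<n+1] = [1..<s] @ s # (s + 1) # [s+2..<n+1]"
  proof -
    have "[1..<n+1] = [1..<s] @ [s..<n+1]"
      using s upt_add_eq_append[of 1 s "n + 1 - s"] by simp
    then show ?thesis using s by (simp add: upt_conv_Cons)
  qed
  \<comment> \<open>Stated for a general \<open>b\<close> so that it applies both to
    \<open>a\<close> and to its swap: the two share \<open>pre\<close> and \<open>R\<close>, which
    do not involve the bits \<open>s\<close> and \<open>s + 1\<close>.\<close>
  have ket_eq: "ket n b = pre * (F s ^ b s * (F (s+1) ^ b (s+1) * R))"
    if "\<And>i. i \<noteq> s \<Longrightarrow> i \<noteq> s + 1 \<Longrightarrow> b i = a i" for b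
  proof -
    have "map (\<lambda>i. F i ^ b i) [1..<s] = map (\<lambda>i. F i ^ a i) [1..<s]"
      "map (\<lambda>i. F i ^ b i) [s+2..<n+1] = map (\<lambda>i. F i ^ a i) [s+2..<n+1]"
      using that by auto
    then show ?thesis
      unfolding ket_def split pre_def R_def F_def
      by (simp only: map_append list.map prod_list.append prod_list.Cons mult.assoc)
  qed
  have R0: "qra_f n i * R = 0" if "i \<in> {s, s + 1}" for i
    unfolding R_def
  proof (rule mult_prod_list_eq_0)
    show "qra_f n i * qra_I n = 0" using that sn by (intro qra_f_qra_I) auto
    fix x assume "x \<in> set (map (\<lambda>i. F i ^ a i) [s+2..<n+1])"
    then obtain k where k: "x = F k ^ a k" "k \<in> {s+2..n}" by auto
    show "qra_f n i * x = x * qra_f n i \<or> qra_f n i * x = - (x * qra_f n i)"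
      unfolding k(1) F_def
      by (intro power_commute_or_anticommute qra_f_anticommute) (use that sn k in auto)
  qed
  have W_pre: "W * pre = pre * W"
    unfolding pre_def
  proof (rule prod_list_commute_left)
    fix x assume "x \<in> set (map (\<lambda>i. F i ^ a i) [1..<s])"
    then obtain k where k: "x = F k ^ a k" "1 \<le> k" "k < s" by auto
    show "W * x = x * W"
      unfolding k(1) F_def W_def
      by (intro power_commute SWAP_succ_commute_qra_fd) (use s k in auto)
  qed
  have W_R: "W * R = R" "W * (F s * R) = F (s+1) * R" "W * (F (s+1) * R) = F s * R"
    "W * (F s * (F (s+1) * R)) = F s * (F (s+1) * R)"
    using two_mode_swap[OF qra_f_square(2)[OF sn(1)] qra_f_square(2)[OF sn(2)]
        qra_f_qra_fd_same[OF sn(1)] qra_f_qra_fd_same[OF sn(2)]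
        qra_f_anticommute(1)[OF sn(2,1) neq] qra_f_anticommute(3)[OF sn(2,1) neq]
        qra_f_anticommute(3)[OF sn neq[symmetric]] qra_f_anticommute(2)[OF sn(2,1) neq]
        R0 R0 W_def[unfolded SWAP_succ_def]]
    unfolding F_def by blast+
  \<comment> \<open>With both exponents 0 or 1, the four cases are exactly those of
    \<open>W_R\<close>. When both bits are 1 the order of \<open>F s\<close> and
    \<open>F (s+1)\<close> is kept, so no sign appears.\<close>
  have bits: "a s \<in> {0, 1}" "a (s+1) \<in> {0, 1}"
    using a[unfolded bit_strings_def] sn by (blast intro: PiE_mem)+
  have "W * ket n a = pre * (W * (F s ^ a s * (F (s+1) ^ a (s+1) * R)))"
    by (simp add: ket_eq mult.assoc[symmetric] W_pre)
  also have "W * (F s ^ a s * (F (s+1) ^ a (s+1) * R)) = F s ^ a (s+1) * (F (s+1) ^ a s * R)"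
    using bits W_R by auto
  also have "pre * \<dots> = ket n (swap_bits s (s + 1) a)"
    by (subst ket_eq) (auto simp: swap_bits_def transpose_def)
  finally show ?thesis by (simp add: W_def)
qed

text \<open>Quantifying over every coefficient family that represents \<open>\<psi>\<close>
  expresses the linear extension without fixing coordinates.\<close>

theorem lemma4p1:
  fixes n s :: nat and \<psi> :: clifford
  assumes "0 < n" and "1 \<le> s" and "s < n"
    and "\<psi> \<in> qubits n"
  shows "SWAP_succ n s \<in> QRA n
    \<and> (\<forall>a\<in>bit_strings n. SWAP_succ n s * ket n a = ket n (swap_bits s (s + 1) a))
    \<and> (\<forall>c \<in> bit_strings n \<rightarrow> qra_complex n.
         \<psi> = (\<Sum>a\<in>bit_strings n. c a * ket n a) \<longrightarrow>
         SWAP_succ n s * \<psi> = (\<Sum>a\<in>bit_strings n. c a * ket n (swap_bits s (s + 1) a)))"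
proof -
  have W: "SWAP_succ n s \<in> qra_pairs n"
    unfolding SWAP_succ_def using assms(2,3)
    by (intro qra_pairs_add qra_pairs_diff qra_pairs_mult qra_f_in_qra_pairs) auto
  have ket: "SWAP_succ n s * ket n a = ket n (swap_bits s (s + 1) a)" if "a \<in> bit_strings n" for a
    using SWAP_succ_ket[OF assms(2,3) that] .
  have "SWAP_succ n s * (\<Sum>a\<in>bit_strings n. c a * ket n a)
      = (\<Sum>a\<in>bit_strings n. c a * ket n (swap_bits s (s + 1) a))"
    if c: "c \<in> bit_strings n \<rightarrow> qra_complex n" for c
    unfolding sum_distrib_left
  proof (rule sum.cong[OF refl])
    fix a assume a: "a \<in> bit_strings n"
    \<comment> \<open>The scalar stands between the gate and the ket, so the gate must first pass
      it.\<close>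
    then have "SWAP_succ n s * c a = c a * SWAP_succ n s"
      using c W by (auto intro: qra_complex_commute_qra_pairs)
    then show "SWAP_succ n s * (c a * ket n a) = c a * ket n (swap_bits s (s + 1) a)"
      by (metis ket[OF a] mult.assoc)
  qed
  then show ?thesis
    using W qra_pairs_subset_QRA ket by blast
qed

end
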